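(* Let $S\ge 1$ and $K\ge 0$ be integers, let $\lambda=\frac{\delta t}{\Delta t}>0$, and let an outer explicit $S$-stage Runge-Kutta method with nodes $c_1,\dots,c_S$, coefficients $a_{s,l}$ and weights $b_s$ be given, with $c_1=0$ and $c_s\neq 0$ for $2\le s\le S$. Suppose the outer method is consistent, i.e. $\sum_{l=1}^{s-1}a_{s,l}=c_s$ for $s=1,\dots,S$, and first order accurate, i.e. $\sum_{s=1}^S b_s=1$. Let $(\overline{c},\overline{A},\overline{b})$ be the Butcher tableau, with $S(K+1)$ stages, of the Projective Runge-Kutta (PRK) method built from this outer method with $K+1$ inner forward Euler steps per outer stage and step size ratio $\lambda$ (defined in the context). Then: (i) the PRK method is consistent: each row sum of $\overline{A}$ equals the corresponding entry of $\overline{c}$; (ii) the PRK method is at least first order accurate: the sum of all entries of $\overline{b}$ equals $1$; (iii) if in addition the outer method is second order accurate, i.e. $\sum_{s=1}^S b_s c_s=\frac12$, then the PRK method recovers second order accuracy for vanishing $\lambda$: with $K$ and the outer method fixed, $\sum_i \overline{b}_i\,\overline{c}_i\to\frac12$ as $\lambda=\frac{\delta t}{\Delta t}\to 0$, where $i$ runs over all $S(K+1)$ stages.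
   Context: An explicit Runge-Kutta method with $N$ stages for $u'=f(u)$ is given by a Butcher tableau $(c,A,b)$ with $c,b\in\mathbb{R}^N$ and $A\in\mathbb{R}^{N\times N}$ strictly lower triangular. It is called consistent if $\sum_{j=1}^{i-1}a_{i,j}=c_i$ for all $i$; it satisfies the first-order accuracy condition if $\sum_j b_j=1$; it satisfies the second-order accuracy condition if, moreover, $\sum_j b_jc_j=\frac12$. The Projective Runge-Kutta (PRK) method with inner step size $\delta t$ and outer step size $\Delta t$ performs, in each of the $S$ outer stages, $K+1$ forward Euler steps of size $\delta t$. The first outer stage starts from $u^{n,0}=u^n$, giving $u^{n,1},\dots,u^{n,K+1}$ and the slope $k_1=(u^{n,K+1}-u^{n,K})/\delta t$. For $2\le s\le S$, stage $s$ starts from $u^{n,K+1}+(c_s\Delta t-(K+1)\delta t)\sum_{l=1}^{s-1}\frac{a_{s,l}}{c_s}k_l$, and $k_s$ is the slope of its last (that is, $(K+1)$-st) inner Euler step. The update is $u^{n+1}=u^{n,K+1}+(\Delta t-(K+1)\delta t)\sum_{s=1}^S b_sk_s$. Written as a Runge-Kutta method with step size $\Delta t$, its stages are indexed by pairs $(s,k)$, $1\le s\le S$, $0\le k\le K$, ordered lexicographically. With $\lambda=\delta t/\Delta t$ and $\widetilde a_{s,l}=\left(\frac{c_s}{\lambda}-(K+1)\right)\frac{a_{s,l}}{c_s}$ for $1\le l<s$, its tableau $(\overline c,\overline A,\overline b)$ is: - $\overline c_{(s,k)}=c_s+k\lambda$ (where $c_1=0$). - $\overline A_{(s,k),(s,m)}=\lambda$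 if $m<k$, and $0$ if $m\ge k$. - For $s\ge2$: $\overline A_{(s,k),(1,m)}=\lambda$ if $m<K$, and $\overline A_{(s,k),(1,K)}=\lambda(1+\widetilde a_{s,1})$. - For $2\le l<s$: $\overline A_{(s,k),(l,m)}=0$ if $m<K$, and $\overline A_{(s,k),(l,K)}=\lambda\,\widetilde a_{s,l}$. - $\overline A_{(s,k),(l,m)}=0$ for $l>s$. - $\overline b_{(1,m)}=\lambda$ for $m<K$, and $\overline b_{(1,K)}=\lambda\left(1+\left(\frac1\lambda-(K+1)\right)b_1\right)$. - For $s\ge2$: $\overline b_{(s,m)}=0$ for $m<K$, and $\overline b_{(s,K)}=\lambda\left(\frac1\lambda-(K+1)\right)b_s$. *)

theory Defs
  imports Complex_Main "HOL-Library.Product_Lexorder"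
begin

text \<open>
  The stages of a Runge-Kutta method are labelled by a finite set of a linearly ordered type, so
  that the stages of a projective method can be labelled by the pairs \<open>(s, k)\<close>, ordered
  lexicographically. Only entries at labels in \<open>stages T\<close> are significant.
\<close>

record 'i butcher_tableau =
  stages :: "'i set"
  node :: "'i \<Rightarrow> real"
  coeff :: "'i \<Rightarrow> 'i \<Rightarrow> real"
  weight :: "'i \<Rightarrow> real"

definition explicit_rk :: "'i::linorder butcher_tableau \<Rightarrow> bool" where
  "explicit_rk T \<longleftrightarrow> finite (stages T) \<and>
     (\<forall>i\<in>stages T. \<forall>j\<in>stages T. i \<le> j \<longrightarrow> coeff T i j = 0)"

definition consistent_rk :: "'i::linorder butcher_tableau \<Rightarrow> bool" where
  "consistent_rk T \<longleftrightarrow>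
     (\<forall>i\<in>stages T. (\<Sum>j\<in>{j \<in> stages T. j < i}. coeff T i j) = node T i)"

definition first_order_rk :: "'i butcher_tableau \<Rightarrow> bool" where
  "first_order_rk T \<longleftrightarrow> (\<Sum>i\<in>stages T. weight T i) = 1"

definition second_order_rk :: "'i butcher_tableau \<Rightarrow> bool" where
  "second_order_rk T \<longleftrightarrow>
     first_order_rk T \<and> (\<Sum>i\<in>stages T. weight T i * node T i) = 1 / 2"

lemma explicit_rk_consistent_iff_row_sums:
  assumes "explicit_rk T"
  shows "consistent_rk T \<longleftrightarrow> (\<forall>i\<in>stages T. (\<Sum>j\<in>stages T. coeff T i j) = node T i)"
proof -
  have "(\<Sum>j\<in>{j \<in> stages T. j < i}. coeff T i j) = (\<Sum>j\<in>stages T. coeff T i j)"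
    if "i \<in> stages T" for i
    using assms that by (intro sum.mono_neutral_left) (auto simp: explicit_rk_def not_less)
  then show ?thesis
    by (simp add: consistent_rk_def)
qed

text \<open>
  In the following, \<open>T\<close> is the outer method, with stages labelled \<open>1, \<dots>, S\<close>; each outer stage
  performs \<open>K + 1\<close> inner forward Euler steps, and \<open>r\<close> is the ratio of the inner to the outer
  step size. Stage \<open>s \<ge> 2\<close> starts from the last iterate \<open>u1\<close> of stage 1, extrapolated along the slopes
  \<open>k_l\<close> of the last Euler step of each earlier stage: if the outer step size is \<open>h\<close>, it starts
  from \<open>u1 + r * h * (\<Sum>l<s. prk_extrap T K r s l * k_l)\<close>. Hence in \<open>prk_coeff\<close> only the labels
  \<open>(l, K)\<close> carry an extrapolation term, and all Euler steps of stage 1 contribute an additional \<open>r\<close>.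
  The final update has the same form, with target time 1 and weights in place of coefficients.
\<close>

definition prk_extrap :: "nat butcher_tableau \<Rightarrow> nat \<Rightarrow> real \<Rightarrow> nat \<Rightarrow> nat \<Rightarrow> real" where
  "prk_extrap T K r s l = (node T s / r - (real K + 1)) * (coeff T s l / node T s)"

definition prk_coeff ::
    "nat butcher_tableau \<Rightarrow> nat \<Rightarrow> real \<Rightarrow> nat \<times> nat \<Rightarrow> nat \<times> nat \<Rightarrow> real" where
  "prk_coeff T K r = (\<lambda>(s, k) (l, m).
     if l = s then (if m < k then r else 0)
     else if l < s then
       (if l = 1 then (if m < K then r else r * (1 + prk_extrap T K r s 1))
        else (if m < K then 0 else r * prk_extrap T K r s l))
     else 0)"

definition prk_weight :: "nat butcher_tableau \<Rightarrow> nat \<Rightarrow> real \<Rightarrow> nat \<times> nat \<Rightarrow> real" where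
  "prk_weight T K r = (\<lambda>(s, m).
     if s = 1 then (if m < K then r else r * (1 + (1 / r - (real K + 1)) * weight T 1))
     else (if m < K then 0 else r * ((1 / r - (real K + 1)) * weight T s)))"

definition prk :: "nat butcher_tableau \<Rightarrow> nat \<Rightarrow> real \<Rightarrow> (nat \<times> nat) butcher_tableau" where
  "prk T K r =
     \<lparr> stages = stages T \<times> {0..K},
       node = (\<lambda>(s, k). node T s + real k * r),
       coeff = prk_coeff T K r,
       weight = prk_weight T K r \<rparr>"

lemma explicit_rk_prk: "explicit_rk T \<Longrightarrow> explicit_rk (prk T K r)"
  by (auto simp: explicit_rk_def prk_def prk_coeff_def less_eq_prod_def)

end

theory Submission
  imports Defs
begin

text \<open>
  Each entry of the projective tableau splits into a term from the Euler steps of the current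
  stage, a term \<open>r\<close> from the Euler steps of stage 1, and an extrapolation term at the last label
  \<open>K\<close>. In a row sum with \<open>s \<ge> 2\<close> and in the sum of the weights, the \<open>(K + 1) * r\<close> contributed by
  stage 1 cancels exactly the shortening of the extrapolation. The second-order sum equals
  \<open>r\<^sup>2 * (\<Sum>m\<le>K. m) + (1 - (K + 1) * r) * (1 / 2 + K * r)\<close>, which tends to \<open>1 / 2\<close>.
\<close>

text \<open>Each summand depends on its own condition, so the sums over \<open>m\<close> and
  \<open>l\<close> separate. The \<open>1 +\<close> in the entry for \<open>(1, K)\<close> is
  absorbed by the middle summand; its guard \<open>1 < s\<close> keeps it out of the rows of stage
  1.\<close>

lemma prk_coeff_split:
  assumes "m \<le> K"
  shows "prk_coeff T K r (s, k) (l, m) =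
    (if l = s then (if m < k then r else 0) else 0) +
    (if l = 1 then (if 1 < s then r else 0) else 0) +
    (if m = K then (if l < s then r * prk_extrap T K r s l else 0) else 0)"
  using assms by (auto simp: prk_coeff_def algebra_simps)

lemma prk_weight_split:
  assumes "m \<le> K" "r \<noteq> 0"
  shows "prk_weight T K r (s, m) =
    (if s = 1 then r else 0) + (if m = K then (1 - (real K + 1) * r) * weight T s else 0)"
  using assms by (auto simp: prk_weight_def field_simps)

text \<open>By consistency the quotients \<open>coeff T s l / node T s\<close> add up to 1, so only
  the common factor \<open>r * (node T s / r - (K + 1))\<close> survives.\<close>

lemma sum_prk_extrap:
  assumes "consistent_rk T" "s \<in> stages T" "node T s \<noteq> 0" "r \<noteq> 0"
  shows "(\<Sum>l | l \<in> stages T \<and> l < s. r * prk_extrap T K r s l) = node T s - (real K + 1) * r"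
proof -
  have "(\<Sum>l | l \<in> stages T \<and> l < s. r * prk_extrap T K r s l) =
      r * (node T s / r - (real K + 1)) / node T s * (\<Sum>l | l \<in> stages T \<and> l < s. coeff T s l)"
    by (simp add: prk_extrap_def sum_distrib_left mult.assoc)
  also have "\<dots> = node T s - (real K + 1) * r"
    using assms by (simp add: consistent_rk_def field_simps)
  finally show ?thesis .
qed

text \<open>The extrapolation sum stays unevaluated: \<open>sum_prk_extrap\<close> requires a
  nonzero node, which stage 1 does not have.\<close>

lemma sum_prk_coeff:
  fixes T :: "nat butcher_tableau"
  assumes "finite (stages T)" "1 \<in> stages T" "s \<in> stages T" "k \<le> K"
  shows "(\<Sum>j\<in>stages (prk T K r). coeff (prk T K r) (s, k) j) =
    real k * r + (if 1 < s then (real K + 1) * r else 0) +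
    (\<Sum>l | l \<in> stages T \<and> l < s. r * prk_extrap T K r s l)"
proof -
  have euler: "(\<Sum>m = 0..K. if m < k then r else 0) = real k * r"
  proof -
    have "{0..K} \<inter> {m. m < k} = {..<k}"
      using assms by auto
    then show ?thesis
      by (simp add: sum.If_cases)
  qed
  have "(\<Sum>j\<in>stages (prk T K r). coeff (prk T K r) (s, k) j) =
      (\<Sum>l\<in>stages T. \<Sum>m = 0..K. prk_coeff T K r (s, k) (l, m))"
    by (simp add: prk_def sum.cartesian_product)
  also have "\<dots> = (\<Sum>l\<in>stages T.
      (if l = s then real k * r else 0) +
      (if l = 1 then (if 1 < s then (real K + 1) * r else 0) else 0) +
      (if l < s then r * prk_extrap T K r s l else 0))"
  proof (rule sum.cong[OF refl])
    fix l
    have "(\<Sum>m = 0..K. prk_coeff T K r (s, k) (l, m)) =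
        (\<Sum>m = 0..K. if l = s then (if m < k then r else 0) else 0) +
        (\<Sum>m = 0..K. if l = 1 then (if 1 < s then r else 0) else 0) +
        (\<Sum>m = 0..K. if m = K then (if l < s then r * prk_extrap T K r s l else 0) else 0)"
      by (simp only: sum.distrib[symmetric], rule sum.cong[OF refl], rule prk_coeff_split) simp
    then show "(\<Sum>m = 0..K. prk_coeff T K r (s, k) (l, m)) =
      (if l = s then real k * r else 0) +
      (if l = 1 then (if 1 < s then (real K + 1) * r else 0) else 0) +
      (if l < s then r * prk_extrap T K r s l else 0)"
      \<comment> \<open>Deciding \<open>l = s\<close>, which does not involve \<open>m\<close>,
        exposes the inner sum in the form of \<open>euler\<close>.\<close>
      by (cases "l = s") (simp_all add: euler distrib_right add.commute)
  qed
  also have "\<dots> = real k * r + (if 1 < s then (real K + 1) * r else 0) +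
      (\<Sum>l | l \<in> stages T \<and> l < s. r * prk_extrap T K r s l)"
    using assms by (simp add: sum.distrib sum.inter_filter)
  finally show ?thesis .
qed

text \<open>The arbitrary factor \<open>f\<close> serves both order conditions: the constant 1 gives
  the sum of the weights, the node function gives the second-order sum.\<close>

lemma sum_prk_weight_mult:
  fixes T :: "nat butcher_tableau"
  assumes "finite (stages T)" "1 \<in> stages T" "r \<noteq> 0"
  shows "(\<Sum>i\<in>stages (prk T K r). weight (prk T K r) i * f i) =
    r * (\<Sum>m = 0..K. f (1, m)) +
    (1 - (real K + 1) * r) * (\<Sum>s\<in>stages T. weight T s * f (s, K))"
proof -
  have "(\<Sum>i\<in>stages (prk T K r). weight (prk T K r) i * f i) =
      (\<Sum>s\<in>stages T. \<Sum>m = 0..K. prk_weight T K r (s, m) * f (s, m))"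
    by (simp add: prk_def sum.cartesian_product case_prod_unfold)
  also have "\<dots> = (\<Sum>s\<in>stages T. (if s = 1 then r * (\<Sum>m = 0..K. f (1, m)) else 0) +
      (1 - (real K + 1) * r) * (weight T s * f (s, K)))"
  proof (rule sum.cong[OF refl])
    fix s
    have "(\<Sum>m = 0..K. prk_weight T K r (s, m) * f (s, m)) =
        (\<Sum>m = 0..K. if s = 1 then r * f (1, m) else 0) +
        (\<Sum>m = 0..K. if m = K then (1 - (real K + 1) * r) * (weight T s * f (s, K)) else 0)"
      unfolding sum.distrib[symmetric] using assms(3)
      by (intro sum.cong[OF refl]) (simp add: prk_weight_split algebra_simps)
    then show "(\<Sum>m = 0..K. prk_weight T K r (s, m) * f (s, m)) =
      (if s = 1 then r * (\<Sum>m = 0..K. f (1, m)) else 0) +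
      (1 - (real K + 1) * r) * (weight T s * f (s, K))"
      by (simp add: sum_distrib_left)
  qed
  also have "\<dots> = r * (\<Sum>m = 0..K. f (1, m)) +
      (1 - (real K + 1) * r) * (\<Sum>s\<in>stages T. weight T s * f (s, K))"
    using assms by (simp add: sum.distrib sum_distrib_left)
  finally show ?thesis .
qed

theorem theorem1:
  fixes S K :: nat and T :: "nat butcher_tableau"
  assumes "S \<ge> 1"
    and "stages T = {1..S}"
    and "explicit_rk T"
    and "node T 1 = 0"
    and "\<And>s. 2 \<le> s \<Longrightarrow> s \<le> S \<Longrightarrow> node T s \<noteq> 0"
    and "consistent_rk T"
    and "first_order_rk T"
  shows "(\<forall>r>0. consistent_rk (prk T K r) \<and>
            (\<forall>i\<in>stages (prk T K r).
               (\<Sum>j\<in>stages (prk T K r). coeff (prk T K r) i j) = node (prk T K r) i))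
       \<and> (\<forall>r>0. first_order_rk (prk T K r))
       \<and> (second_order_rk T \<longrightarrow>
            ((\<lambda>r. \<Sum>i\<in>stages (prk T K r). weight (prk T K r) i * node (prk T K r) i)
               \<longlongrightarrow> 1 / 2) (at_right 0))"
proof (intro conjI allI impI)
  have fin: "finite (stages T)" and one: "1 \<in> stages T"
    using assms(1,2) by auto
  have rows: "\<forall>i\<in>stages (prk T K r).
      (\<Sum>j\<in>stages (prk T K r). coeff (prk T K r) i j) = node (prk T K r) i" if "r > 0" for r
  proof
    fix i assume "i \<in> stages (prk T K r)"
    then obtain s k where i: "i = (s, k)" and s: "s \<in> stages T" and k: "k \<le> K"
      by (auto simp: prk_def)
    have "real k * r + (if 1 < s then (real K + 1) * r else 0) +
        (\<Sum>l | l \<in> stages T \<and> l < s. r * prk_extrap T K r s l) = node T s + real k * r"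
    \<comment> \<open>For later stages the two multiples of \<open>K + 1\<close> cancel. Stage 1 is
      treated apart: its node is 0 and its extrapolation sum is empty.\<close>
    proof (cases "1 < s")
      case True
      then have "node T s \<noteq> 0"
        using assms(2,5) s by simp
      with True show ?thesis
        using sum_prk_extrap[OF assms(6) s] that by simp
    next
      case False
      then have "s = 1"
        using assms(2) s by simp
      moreover from this have "{l \<in> stages T. l < s} = {}"
        using assms(2) by simp
      ultimately show ?thesis
        using assms(4) by (simp only: sum.empty) simp
    qed
    then show "(\<Sum>j\<in>stages (prk T K r). coeff (prk T K r) i j) = node (prk T K r) i"
      unfolding i using sum_prk_coeff[OF fin one s k, of r] by (simp add: prk_def)
  qed
  fix r :: real assume r: "r > 0"
  show "\<forall>i\<in>stages (prk T K r).
      (\<Sum>j\<in>stages (prk T K r). coeff (prk T K r) i j) = node (prk T K r) i"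
    by (rule rows[OF r])
  \<comment> \<open>\<open>consistent_rk\<close> sums only over lexicographically earlier labels;
    explicitness of the projective method makes this the full row sum.\<close>
  show "consistent_rk (prk T K r)"
    using rows[OF r] explicit_rk_consistent_iff_row_sums[OF explicit_rk_prk[OF assms(3)]] by blast
next
  fix r :: real assume "r > 0"
  then show "first_order_rk (prk T K r)"
    using sum_prk_weight_mult[of T r K "\<lambda>_. 1"] assms(1,2,7)
    by (simp add: first_order_rk_def algebra_simps)
next
  assume so: "second_order_rk T"
  have eq: "(\<Sum>i\<in>stages (prk T K r). weight (prk T K r) i * node (prk T K r) i) =
      r * (\<Sum>m = 0..K. real m * r) + (1 - (real K + 1) * r) * (1 / 2 + real K * r)"
    if "r > 0" for r
  proof -
    \<comment> \<open>The outer weights sit at the labels \<open>(s, K)\<close>, whose nodes are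
      shifted by \<open>K * r\<close>. As these weights sum to 1, the shift passes unchanged to the
      weighted mean.\<close>
    have "(\<Sum>s\<in>stages T. weight T s * (node T s + real K * r)) =
        (\<Sum>s\<in>stages T. weight T s * node T s) + (\<Sum>s\<in>stages T. weight T s) * (real K * r)"
      by (simp add: distrib_left sum.distrib sum_distrib_right)
    also have "\<dots> = 1 / 2 + real K * r"
      using so by (simp add: second_order_rk_def first_order_rk_def)
    finally have "(\<Sum>s\<in>stages T. weight T s * node (prk T K r) (s, K)) = 1 / 2 + real K * r"
      by (simp add: prk_def)
    moreover have "(\<Sum>m = 0..K. node (prk T K r) (1, m)) = (\<Sum>m = 0..K. real m * r)"
      using assms(4) by (simp add: prk_def)
    ultimately show ?thesis
      using sum_prk_weight_mult[of T r K "node (prk T K r)"] assms(1,2) that by simp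
  qed
  \<comment> \<open>The closed form is a polynomial in \<open>r\<close>; the limit is first written
    as its unsimplified value at 0, to match the limit rules.\<close>
  have "((\<lambda>r. r * (\<Sum>m = 0..K. real m * r) + (1 - (real K + 1) * r) * (1 / 2 + real K * r))
      \<longlongrightarrow> 0 * (\<Sum>m = 0..K. real m * 0) + (1 - (real K + 1) * 0) * (1 / 2 + real K * 0)) (at_right 0)"
    by (intro tendsto_intros)
  then have "((\<lambda>r. r * (\<Sum>m = 0..K. real m * r) + (1 - (real K + 1) * r) * (1 / 2 + real K * r))
      \<longlongrightarrow> 1 / 2) (at_right 0)"
    by simp
  \<comment> \<open>The closed form is valid for \<open>r > 0\<close>, which suffices for the
    right-sided limit; at \<open>r = 0\<close> every projective weight is 0 and the equality
    fails.\<close>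
  then show "((\<lambda>r. \<Sum>i\<in>stages (prk T K r). weight (prk T K r) i * node (prk T K r) i)
      \<longlongrightarrow> 1 / 2) (at_right 0)"
    by (rule Lim_transform_eventually)
      (use eq in \<open>auto simp: eventually_at_filter intro!: always_eventually\<close>)
qed

end
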